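(* Let $M$ and $N$ be left cancellative, finitely generated monoids which are quasi-isometric. Then $M$ is finitely presentable if and only if $N$ is finitely presentable.
   Context: A monoid $M$ is left cancellative if $xy=xz$ implies $y=z$ for all $x,y,z\in M$. A monoid is finitely presentable if it is isomorphic to the monoid defined by a monoid presentation $\langle A\mid R\rangle$ with $A$ and $R$ finite. Let $\mathbb{R}^\infty=\mathbb{R}^{\ge 0}\cup\{\infty\}$ with the obvious order, addition and multiplication ($0\cdot\infty$ undefined; $\infty/\lambda-\epsilon=\infty$). A semimetric on a set $X$ is a function $d:X\times X\to\mathbb{R}^\infty$ such that $d(x,y)=0$ if and only if $x=y$, and $d(x,z)\le d(x,y)+d(y,z)$ for all $x,y,z$ (symmetry is not required). A semimetric space is a set with a semimetric. Let $1\le\lambda<\infty$, $0\le\mu<\infty$, $0<\epsilon<\infty$. A map $f:X\to Y$ between semimetric spaces is a $(\lambda,\epsilon)$-quasi-isometric embedding if $\frac1\lambda d_X(x,y)-\epsilon\le d_Y(f(x),f(y))\le\lambda d_X(x,y)+\epsilon$ for all $x,y\in X$. A subset $Z\subseteq Y$ is $\mu$-quasi-dense if for every $y\in Y$ there is $z\in Z$ with $d_Y(y,z)\le\mu$ and $d_Y(z,y)\le\mu$. A $(\lambda,\epsilon,\mu)$-quasi-isometry is a $(\lambda,\epsilon)$-quasi-isometric embedding whose image is $\mu$-quasi-dense. $X$ and $Y$ are quasi-isometric if there is a $(\lambda,\epsilon,\mu)$-quasi-isometry $X\to Y$ for some such constants; this is an equivalence relation. For a monoid $M$ generated by a finite subset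 $S$, define the semimetric $d_S$ on $M$ by letting $d_S(x,y)$ be the shortest length of a word $w$ over $S$ with $xw=y$ in $M$, or $\infty$ if there is no such word. Different finite generating sets of the same monoid give quasi-isometric semimetric spaces. Two finitely generated monoids are quasi-isometric if the semimetric spaces so obtained from (any) finite generating sets are quasi-isometric. *)

theory Defs
  imports "HOL-Algebra.Group" "HOL-Library.Extended_Nonnegative_Real"
begin

section \<open>Left cancellative monoids and generating sets\<close>

locale left_cancellative_monoid = monoid +
  assumes left_cancel:
    "\<lbrakk>x \<in> carrier G; y \<in> carrier G; z \<in> carrier G; x \<otimes> y = x \<otimes> z\<rbrakk> \<Longrightarrow> y = z"

definition word_value :: "('a, 'm) monoid_scheme \<Rightarrow> 'a list \<Rightarrow> 'a" where
  "word_value M w = foldr (\<otimes>\<^bsub>M\<^esub>) w \<one>\<^bsub>M\<^esub>"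

definition generates :: "('a, 'm) monoid_scheme \<Rightarrow> 'a set \<Rightarrow> bool" where
  "generates M S \<longleftrightarrow>
     S \<subseteq> carrier M \<and> (\<forall>x \<in> carrier M. \<exists>w \<in> lists S. word_value M w = x)"

definition finitely_generated :: "('a, 'm) monoid_scheme \<Rightarrow> bool" where
  "finitely_generated M \<longleftrightarrow> (\<exists>S. finite S \<and> generates M S)"


section \<open>Finite presentability\<close>

text \<open>The least congruence containing \<open>R\<close> on the free monoid of all words over \<open>A\<close>.\<close>

inductive_set presentation_cong :: "'x set \<Rightarrow> ('x list \<times> 'x list) set \<Rightarrow> ('x list \<times> 'x list) set"
  for A R
where
  rel: "(u, v) \<in> R \<Longrightarrow> (u, v) \<in> presentation_cong A R"
| refl: "u \<in> lists A \<Longrightarrow> (u, u) \<in> presentation_cong A R"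
| sym: "(u, v) \<in> presentation_cong A R \<Longrightarrow> (v, u) \<in> presentation_cong A R"
| trans: "\<lbrakk>(u, v) \<in> presentation_cong A R; (v, w) \<in> presentation_cong A R\<rbrakk>
    \<Longrightarrow> (u, w) \<in> presentation_cong A R"
| append: "\<lbrakk>(u, v) \<in> presentation_cong A R; (u', v') \<in> presentation_cong A R\<rbrakk>
    \<Longrightarrow> (u @ u', v @ v') \<in> presentation_cong A R"

definition presented_monoid :: "'x set \<Rightarrow> ('x list \<times> 'x list) set \<Rightarrow> 'x list set monoid" where
  "presented_monoid A R =
     \<lparr>carrier = lists A // presentation_cong A R,
      mult = (\<lambda>U V. \<Union>u\<in>U. \<Union>v\<in>V. presentation_cong A R `` {u @ v}),
      one = presentation_cong A R `` {[]}\<rparr>"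

text \<open>
  The letters are taken to be natural numbers; as the alphabet is finite, this is no restriction.
  An isomorphism in the sense of \<open>\<cong>\<close> is a multiplicative bijection; between monoids it
  automatically preserves the unit.
\<close>

definition finitely_presentable :: "('a, 'm) monoid_scheme \<Rightarrow> bool" where
  "finitely_presentable M \<longleftrightarrow>
     (\<exists>(A :: nat set) R. finite A \<and> finite R \<and> R \<subseteq> lists A \<times> lists A \<and>
        M \<cong> presented_monoid A R)"

lemma presentation_cong_equiv:
  assumes "R \<subseteq> lists A \<times> lists A"
  shows "equiv (lists A) (presentation_cong A R)"
proof -
  have "(u, v) \<in> lists A \<times> lists A" if "(u, v) \<in> presentation_cong A R" for u v
    using that by induction (use assms in auto)
  then show ?thesis
    by (auto intro!: equivI refl_onI symI transI
          intro: presentation_cong.refl presentation_cong.sym presentation_cong.trans)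
qed

lemma presented_monoid_mult_class:
  assumes R: "R \<subseteq> lists A \<times> lists A" and uv: "u \<in> lists A" "v \<in> lists A"
  shows "(presentation_cong A R `` {u}) \<otimes>\<^bsub>presented_monoid A R\<^esub> (presentation_cong A R `` {v})
    = presentation_cong A R `` {u @ v}"
proof -
  note eq = presentation_cong_equiv[OF R]
  let ?C = "\<lambda>w. presentation_cong A R `` {w}"
  have "?C (u' @ v') = ?C (u @ v)" if "u' \<in> ?C u" "v' \<in> ?C v" for u' v'
    using that equiv_class_eq[OF eq presentation_cong.append[of u u' A R v v']] by simp
  then have "(\<Union>u'\<in>?C u. \<Union>v'\<in>?C v. ?C (u' @ v')) = (\<Union>u'\<in>?C u. \<Union>v'\<in>?C v. ?C (u @ v))"
    by (intro SUP_cong[OF HOL.refl])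
  also have "\<dots> = ?C (u @ v)"
  proof -
    have "u \<in> ?C u" "v \<in> ?C v"
      using uv by (auto intro: presentation_cong.refl)
    then have "?C u \<noteq> {}" "?C v \<noteq> {}" by blast+
    then show ?thesis by (simp only: UN_constant if_False)
  qed
  finally show ?thesis
    by (simp only: presented_monoid_def monoid.simps)
qed

lemma presented_monoid_is_monoid:
  assumes R: "R \<subseteq> lists A \<times> lists A"
  shows "monoid (presented_monoid A R)"
proof -
  have carrier: "\<exists>u \<in> lists A. x = presentation_cong A R `` {u}"
    if "x \<in> carrier (presented_monoid A R)" for x
    using that by (auto simp: presented_monoid_def elim: quotientE)
  have cls: "presentation_cong A R `` {u} \<in> carrier (presented_monoid A R)"
    if "u \<in> lists A" for u
    using that by (simp add: presented_monoid_def quotientI)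
  have one: "\<one>\<^bsub>presented_monoid A R\<^esub> = presentation_cong A R `` {[]}"
    by (simp add: presented_monoid_def)
  note mult = presented_monoid_mult_class[OF R]
  have append: "u @ v \<in> lists A" if "u \<in> lists A" "v \<in> lists A" for u v
    using that by simp
  have nil: "[] \<in> lists A" by simp
  show ?thesis
  proof (rule monoidI)
    fix x y
    assume "x \<in> carrier (presented_monoid A R)" "y \<in> carrier (presented_monoid A R)"
    then obtain u v where "u \<in> lists A" "v \<in> lists A"
      "x = presentation_cong A R `` {u}" "y = presentation_cong A R `` {v}"
      using carrier by meson
    then show "x \<otimes>\<^bsub>presented_monoid A R\<^esub> y \<in> carrier (presented_monoid A R)"
      by (simp only: mult append cls)
  next
    show "\<one>\<^bsub>presented_monoid A R\<^esub> \<in> carrier (presented_monoid A R)"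
      using cls[OF nil] one by simp
  next
    fix x y z
    assume "x \<in> carrier (presented_monoid A R)" "y \<in> carrier (presented_monoid A R)"
      "z \<in> carrier (presented_monoid A R)"
    then obtain u v w where "u \<in> lists A" "v \<in> lists A" "w \<in> lists A"
      "x = presentation_cong A R `` {u}" "y = presentation_cong A R `` {v}"
      "z = presentation_cong A R `` {w}"
      using carrier by meson
    then show "x \<otimes>\<^bsub>presented_monoid A R\<^esub> y \<otimes>\<^bsub>presented_monoid A R\<^esub> z
        = x \<otimes>\<^bsub>presented_monoid A R\<^esub> (y \<otimes>\<^bsub>presented_monoid A R\<^esub> z)"
      by (simp only: mult append append_assoc)
  next
    fix x
    assume "x \<in> carrier (presented_monoid A R)"
    then obtain u where "u \<in> lists A" "x = presentation_cong A R `` {u}"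
      using carrier by meson
    then show "\<one>\<^bsub>presented_monoid A R\<^esub> \<otimes>\<^bsub>presented_monoid A R\<^esub> x = x"
      and "x \<otimes>\<^bsub>presented_monoid A R\<^esub> \<one>\<^bsub>presented_monoid A R\<^esub> = x"
      by (simp_all only: one mult nil append_Nil append_Nil2)
  qed
qed


section \<open>Semimetric spaces and quasi-isometries\<close>

locale semimetric_space =
  fixes X :: "'a set" and d :: "'a \<Rightarrow> 'a \<Rightarrow> ennreal"
  assumes dist_eq_0_iff: "\<lbrakk>x \<in> X; y \<in> X\<rbrakk> \<Longrightarrow> d x y = 0 \<longleftrightarrow> x = y"
    and dist_triangle: "\<lbrakk>x \<in> X; y \<in> X; z \<in> X\<rbrakk> \<Longrightarrow> d x z \<le> d x y + d y z"

text \<open>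
  Subtraction on \<^typ>\<open>ennreal\<close> is truncated at \<open>0\<close>, which is harmless in a lower bound for a
  distance, and satisfies \<open>\<infinity> - e = \<infinity>\<close> for finite \<open>e\<close>.
\<close>

definition quasi_isometric_embedding ::
  "real \<Rightarrow> real \<Rightarrow> 'a set \<Rightarrow> ('a \<Rightarrow> 'a \<Rightarrow> ennreal) \<Rightarrow> 'b set \<Rightarrow> ('b \<Rightarrow> 'b \<Rightarrow> ennreal) \<Rightarrow>
    ('a \<Rightarrow> 'b) \<Rightarrow> bool" where
  "quasi_isometric_embedding l \<epsilon> X dX Y dY f \<longleftrightarrow>
     f \<in> X \<rightarrow> Y \<and>
     (\<forall>x\<in>X. \<forall>y\<in>X. dX x y / ennreal l - ennreal \<epsilon> \<le> dY (f x) (f y) \<and>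
                   dY (f x) (f y) \<le> ennreal l * dX x y + ennreal \<epsilon>)"

definition quasi_dense ::
  "real \<Rightarrow> 'b set \<Rightarrow> ('b \<Rightarrow> 'b \<Rightarrow> ennreal) \<Rightarrow> 'b set \<Rightarrow> bool" where
  "quasi_dense \<mu> Y dY Z \<longleftrightarrow>
     Z \<subseteq> Y \<and> (\<forall>y\<in>Y. \<exists>z\<in>Z. dY y z \<le> ennreal \<mu> \<and> dY z y \<le> ennreal \<mu>)"

definition quasi_isometry ::
  "real \<Rightarrow> real \<Rightarrow> real \<Rightarrow> 'a set \<Rightarrow> ('a \<Rightarrow> 'a \<Rightarrow> ennreal) \<Rightarrow> 'b set \<Rightarrow> ('b \<Rightarrow> 'b \<Rightarrow> ennreal) \<Rightarrow>
    ('a \<Rightarrow> 'b) \<Rightarrow> bool" where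
  "quasi_isometry l \<epsilon> \<mu> X dX Y dY f \<longleftrightarrow>
     quasi_isometric_embedding l \<epsilon> X dX Y dY f \<and> quasi_dense \<mu> Y dY (f ` X)"

definition quasi_isometric ::
  "'a set \<Rightarrow> ('a \<Rightarrow> 'a \<Rightarrow> ennreal) \<Rightarrow> 'b set \<Rightarrow> ('b \<Rightarrow> 'b \<Rightarrow> ennreal) \<Rightarrow> bool" where
  "quasi_isometric X dX Y dY \<longleftrightarrow>
     (\<exists>l \<epsilon> \<mu> f. 1 \<le> l \<and> 0 < \<epsilon> \<and> 0 \<le> \<mu> \<and> quasi_isometry l \<epsilon> \<mu> X dX Y dY f)"


section \<open>The word semimetric\<close>

text \<open>The infimum over the empty set is \<open>\<infinity>\<close>.\<close>

definition word_dist :: "('a, 'm) monoid_scheme \<Rightarrow> 'a set \<Rightarrow> 'a \<Rightarrow> 'a \<Rightarrow> ennreal" where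
  "word_dist M S x y =
     (INF w \<in> {w \<in> lists S. x \<otimes>\<^bsub>M\<^esub> word_value M w = y}. of_nat (length w))"

text \<open>
  Different finite generating sets of a monoid give quasi-isometric spaces, so it does not matter
  which finite generating sets are used.
\<close>

definition quasi_isometric_monoids ::
  "('a, 'm) monoid_scheme \<Rightarrow> ('b, 'n) monoid_scheme \<Rightarrow> bool" where
  "quasi_isometric_monoids M N \<longleftrightarrow>
     (\<exists>S T. finite S \<and> generates M S \<and> finite T \<and> generates N T \<and>
        quasi_isometric (carrier M) (word_dist M S) (carrier N) (word_dist N T))"

context monoid
begin

lemma word_value_closed: "set w \<subseteq> carrier G \<Longrightarrow> word_value G w \<in> carrier G"
  by (induction w) (auto simp: word_value_def)

lemma word_value_append:
  assumes "set u \<subseteq> carrier G" "set v \<subseteq> carrier G"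
  shows "word_value G (u @ v) = word_value G u \<otimes> word_value G v"
  using assms(1)
proof (induction u)
  case Nil
  then show ?case
    using word_value_closed[OF assms(2)] by (simp add: word_value_def)
next
  case (Cons a u)
  then show ?case
    using word_value_closed[of u] word_value_closed[OF assms(2)]
    by (simp add: word_value_def m_assoc)
qed

lemma word_dist_le:
  assumes "w \<in> lists S" "x \<otimes> word_value G w = y"
  shows "word_dist G S x y \<le> of_nat (length w)"
  unfolding word_dist_def by (rule INF_lower) (use assms in simp)

lemma word_dist_attained:
  assumes "word_dist G S x y \<noteq> \<infinity>"
  obtains w where "w \<in> lists S" "x \<otimes> word_value G w = y"
    "word_dist G S x y = of_nat (length w)"
proof -
  let ?P = "\<lambda>w. w \<in> lists S \<and> x \<otimes> word_value G w = y"
  have "\<exists>w. ?P w"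
  proof (rule ccontr)
    assume "\<nexists>w. ?P w"
    then have "{w \<in> lists S. x \<otimes> word_value G w = y} = {}" by blast
    then have "word_dist G S x y = \<infinity>"
      unfolding word_dist_def by (simp only: image_empty Inf_empty infinity_ennreal_def)
    with assms show False ..
  qed
  then obtain w0 where "?P w0" ..
  then obtain w where w: "?P w" and min: "\<And>v. ?P v \<Longrightarrow> length w \<le> length v"
    using ex_has_least_nat[of ?P w0 length] by blast
  have "word_dist G S x y = of_nat (length w)"
  proof (rule antisym)
    show "word_dist G S x y \<le> of_nat (length w)"
      using w word_dist_le by blast
    show "of_nat (length w) \<le> word_dist G S x y"
      unfolding word_dist_def by (rule INF_greatest) (use min in simp)
  qed
  with w that show thesis by blast
qed

lemma word_dist_semimetric:
  assumes S: "S \<subseteq> carrier G"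
  shows "semimetric_space (carrier G) (word_dist G S)"
proof
  fix x y
  assume x: "x \<in> carrier G" and y: "y \<in> carrier G"
  show "word_dist G S x y = 0 \<longleftrightarrow> x = y"
  proof
    assume 0: "word_dist G S x y = 0"
    then obtain w where "x \<otimes> word_value G w = y" "word_dist G S x y = of_nat (length w)"
      using word_dist_attained[of S x y] by auto
    with 0 x show "x = y" by (auto simp: word_value_def)
  next
    assume "x = y"
    then show "word_dist G S x y = 0"
      using word_dist_le[of "[]" S x y] x by (simp add: word_value_def)
  qed
next
  fix x y z
  assume x: "x \<in> carrier G"
  show "word_dist G S x z \<le> word_dist G S x y + word_dist G S y z"
  proof (cases "word_dist G S x y = \<infinity> \<or> word_dist G S y z = \<infinity>")
    case True
    then show ?thesis by auto
  next
    case False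
    then have fin: "word_dist G S x y \<noteq> \<infinity>" "word_dist G S y z \<noteq> \<infinity>"
      by auto
    obtain u where u: "u \<in> lists S" "x \<otimes> word_value G u = y"
        "word_dist G S x y = of_nat (length u)"
      using word_dist_attained[OF fin(1)] .
    obtain v where v: "v \<in> lists S" "y \<otimes> word_value G v = z"
        "word_dist G S y z = of_nat (length v)"
      using word_dist_attained[OF fin(2)] .
    have sub: "set u \<subseteq> carrier G" "set v \<subseteq> carrier G"
      using u(1) v(1) S by auto
    have "x \<otimes> word_value G (u @ v) = z"
      using u(2) v(2) x sub
      by (simp add: word_value_append word_value_closed flip: m_assoc)
    then have "word_dist G S x z \<le> of_nat (length (u @ v))"
      using u(1) v(1) by (intro word_dist_le) auto
    then show ?thesis using u(3) v(3) by simp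
  qed
qed

end

end

theory Submission
  imports Defs
begin

text \<open>
  Over a finite generating set \<open>S\<close>, a left cancellative monoid is finitely presentable iff for some
  \<open>n\<close> any two words over \<open>S\<close> with the same value are related by finitely many substitutions of
  words of length at most \<open>n\<close> with the same value. By left cancellation, two parallel paths
  in the Cayley graph are labelled by words of the same value, so this condition
  says that parallel paths can be filled by cells of bounded size, wherever they start.

  For a quasi-isometry \<open>f\<close> with quasi-inverse \<open>g\<close>, replace each edge of a path \<open>w\<close> in the second
  Cayley graph by a bounded path joining the \<open>g\<close>-images of its endpoints; apply \<open>f\<close> to the result
  in the same way. The path obtained, extended by bounded paths at both ends, is
  related to \<open>w\<close> by cells of bounded size, and fillings in the first graph are carried to fillings
  in the second.
\<close>

section \<open>Words and congruences\<close>

lemma presentation_cong_lists: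
  assumes "R \<subseteq> lists A \<times> lists A" "(u, v) \<in> presentation_cong A R"
  shows "u \<in> lists A" "v \<in> lists A"
proof -
  from assms(2) have "u \<in> lists A \<and> v \<in> lists A"
    by induction (use assms(1) in auto)
  then show "u \<in> lists A" "v \<in> lists A" by auto
qed

lemma presentation_cong_class_eq_iff:
  assumes "R \<subseteq> lists A \<times> lists A" "u \<in> lists A" "v \<in> lists A"
  shows "presentation_cong A R `` {u} = presentation_cong A R `` {v} \<longleftrightarrow>
    (u, v) \<in> presentation_cong A R"
  using eq_equiv_class_iff[OF presentation_cong_equiv[OF assms(1)] assms(2,3)] .

text \<open>Serves to rename letters in both directions: from an abstract alphabet to generators of
  a monoid, and from generators to natural numbers.\<close>

lemma presentation_cong_map:
  assumes "(u, v) \<in> presentation_cong A R" "k ` A \<subseteq> B"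
    and "\<And>u v. (u, v) \<in> R \<Longrightarrow> (map k u, map k v) \<in> presentation_cong B Q"
  shows "(map k u, map k v) \<in> presentation_cong B Q"
  using assms(1)
proof induction
  case (rel u v)
  then show ?case by (rule assms(3))
next
  case (refl u)
  then show ?case using assms(2) by (intro presentation_cong.refl) (auto simp: image_subset_iff)
next
  case (append u v u' v')
  then show ?case by (simp add: presentation_cong.append)
qed (blast intro: presentation_cong.sym presentation_cong.trans)+

text \<open>Soundness: values are multiplicative on concatenation, so a derivation cannot change a
  value that the defining relations preserve.\<close>

lemma (in monoid) presentation_cong_word_value:
  assumes "(u, v) \<in> presentation_cong A R" and "R \<subseteq> lists A \<times> lists A" and "k ` A \<subseteq> carrier G"
    and "\<And>u v. (u, v) \<in> R \<Longrightarrow> word_value G (map k u) = word_value G (map k v)"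
  shows "word_value G (map k u) = word_value G (map k v)"
  using assms(1)
proof induction
  case (append u v u' v')
  have "set (map k w) \<subseteq> carrier G" if "w \<in> lists A" for w
    using that assms(3) by auto
  with append presentation_cong_lists[OF assms(2)] show ?case
    by (simp only: map_append word_value_append)
qed (use assms(4) in auto)

section \<open>Valid relations of bounded length\<close>

text \<open>All valid relations up to the length bound are taken, so membership is a check of
  lengths and values and no chosen presentation has to be carried along.\<close>

definition bounded_relations :: "('a, 'm) monoid_scheme \<Rightarrow> 'a set \<Rightarrow> nat \<Rightarrow> ('a list \<times> 'a list) set"
  where "bounded_relations M S n =
    {(u, v). u \<in> lists S \<and> v \<in> lists S \<and> length u \<le> n \<and> length v \<le> n \<and>
      word_value M u = word_value M v}"

definition boundedly_presented :: "('a, 'm) monoid_scheme \<Rightarrow> 'a set \<Rightarrow> bool" where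
  "boundedly_presented M S \<longleftrightarrow> (\<exists>n. \<forall>u\<in>lists S. \<forall>v\<in>lists S.
     word_value M u = word_value M v \<longrightarrow> (u, v) \<in> presentation_cong S (bounded_relations M S n))"

lemma bounded_relations_subset: "bounded_relations M S n \<subseteq> lists S \<times> lists S"
  by (auto simp: bounded_relations_def)

lemma finite_bounded_relations:
  assumes "finite S"
  shows "finite (bounded_relations M S n)"
proof (rule finite_subset)
  show "bounded_relations M S n \<subseteq>
      {u. set u \<subseteq> S \<and> length u \<le> n} \<times> {u. set u \<subseteq> S \<and> length u \<le> n}"
    by (auto simp: bounded_relations_def)
  show "finite ({u. set u \<subseteq> S \<and> length u \<le> n} \<times> {u. set u \<subseteq> S \<and> length u \<le> n})"
    using finite_lists_length_le[OF assms] by blast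
qed

lemma bounded_relation_cong:
  assumes "u \<in> lists S" "v \<in> lists S" "length u \<le> n" "length v \<le> n"
    "word_value M u = word_value M v"
  shows "(u, v) \<in> presentation_cong S (bounded_relations M S n)"
  using assms by (intro presentation_cong.rel) (auto simp: bounded_relations_def)


section \<open>Finite presentability and bounded relations\<close>

text \<open>The letters of the presentation, pulled back along the isomorphism, become the
  generators; the longest side of a defining relation gives the bound. The generating set is the one
  the presentation dictates.\<close>

lemma finitely_presentable_imp_boundedly_presented:
  assumes "monoid M" "finitely_presentable M"
  shows "\<exists>S. finite S \<and> generates M S \<and> boundedly_presented M S"
proof -
  interpret M: monoid M by fact
  obtain A :: "nat set" and R h where A: "finite A" and finR: "finite R"
    and R: "R \<subseteq> lists A \<times> lists A" and h: "h \<in> iso M (presented_monoid A R)"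
    using assms(2) unfolding finitely_presentable_def is_iso_def by blast
  let ?P = "presented_monoid A R" and ?C = "\<lambda>u. presentation_cong A R `` {u}"
  have P: "monoid ?P" using presented_monoid_is_monoid[OF R] .
  have hom: "h \<in> hom M ?P" and bij: "bij_betw h (carrier M) (carrier ?P)"
    using h by (auto simp: iso_def)
  have cls: "?C u \<in> carrier ?P" if "u \<in> lists A" for u
    using that by (simp add: presented_monoid_def quotientI)
  have oneP: "\<one>\<^bsub>?P\<^esub> = ?C []" by (simp add: presented_monoid_def)
  \<comment> \<open>An element of \<open>iso\<close> is only required to be multiplicative and
    bijective. If \<open>e\<close> is sent to the unit, then comparing \<open>h e\<close> with the
    image of \<open>e\<close> times the unit of \<open>M\<close> gives the claim.\<close>
  have h1: "h \<one>\<^bsub>M\<^esub> = \<one>\<^bsub>?P\<^esub>"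
  proof -
    interpret P: monoid ?P by (rule P)
    obtain e where e: "e \<in> carrier M" "h e = \<one>\<^bsub>?P\<^esub>"
      using bij P.one_closed by (metis bij_betw_def imageE)
    have "h e = h e \<otimes>\<^bsub>?P\<^esub> h \<one>\<^bsub>M\<^esub>"
      using hom_mult[OF hom e(1) M.one_closed] e(1) by simp
    then show ?thesis
      using e hom M.one_closed by (simp add: hom_in_carrier)
  qed
  define k where "k a = the_inv_into (carrier M) h (?C [a])" for a
  have k: "k a \<in> carrier M" "h (k a) = ?C [a]" if "a \<in> A" for a
  proof -
    have c: "?C [a] \<in> h ` carrier M"
      using cls[of "[a]"] that bij by (simp add: bij_betw_def)
    have inj: "inj_on h (carrier M)" using bij by (simp add: bij_betw_def)
    show "k a \<in> carrier M"
      unfolding k_def using the_inv_into_into[OF inj c subset_refl] .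
    show "h (k a) = ?C [a]"
      unfolding k_def using f_the_inv_into_f[OF inj c] .
  qed
  let ?S = "k ` A"
  have S: "?S \<subseteq> carrier M" using k by auto
  have closed: "word_value M (map k u) \<in> carrier M" if "u \<in> lists A" for u
    using that S by (intro M.word_value_closed) auto
  have val: "h (word_value M (map k u)) = ?C u" if "u \<in> lists A" for u
    using that
  proof (induction u)
    case Nil
    then show ?case by (simp add: word_value_def h1 oneP)
  next
    case (Cons a u)
    have "h (word_value M (map k (a # u))) = h (k a) \<otimes>\<^bsub>?P\<^esub> h (word_value M (map k u))"
      using hom_mult[OF hom k(1) closed] Cons.hyps by (simp add: word_value_def)
    then show ?case
      using Cons k(2) presented_monoid_mult_class[OF R, of "[a]" u] by simp
  qed
  have value_eq: "word_value M (map k u) = word_value M (map k v) \<longleftrightarrow>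
      (u, v) \<in> presentation_cong A R" if "u \<in> lists A" "v \<in> lists A" for u v
    using presentation_cong_class_eq_iff[OF R that] val[OF that(1)] val[OF that(2)]
      closed[OF that(1)] closed[OF that(2)] bij
    by (metis bij_betw_imp_inj_on inj_on_eq_iff)
  have "generates M ?S"
    unfolding generates_def
  proof (intro conjI ballI S)
    fix x
    assume x: "x \<in> carrier M"
    then have "h x \<in> lists A // presentation_cong A R"
      using hom_in_carrier[OF hom] by (simp add: presented_monoid_def)
    then obtain u where u: "u \<in> lists A" "h x = ?C u" unfolding quotient_def by blast
    then have "word_value M (map k u) = x"
      using val[OF u(1)] closed[OF u(1)] x bij by (metis bij_betw_imp_inj_on inj_on_eq_iff)
    then show "\<exists>w\<in>lists ?S. word_value M w = x"
      using u(1) by (intro bexI[of _ "map k u"]) auto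
  qed
  moreover have "boundedly_presented M ?S"
  proof -
    \<comment> \<open>The inserted 0 keeps \<open>Max\<close> meaningful when \<open>R\<close> is
      empty.\<close>
    define n where "n = Max (insert 0 (length ` (fst ` R \<union> snd ` R)))"
    have n: "length u \<le> n \<and> length v \<le> n" if "(u, v) \<in> R" for u v
      unfolding n_def using that finR by (force intro!: Max_ge)
    have "(u, v) \<in> presentation_cong ?S (bounded_relations M ?S n)"
      if uv: "u \<in> lists ?S" "v \<in> lists ?S" "word_value M u = word_value M v" for u v
    proof -
      \<comment> \<open>The map \<open>k\<close> need not be injective on \<open>A\<close>, but any
        lifts will do: by \<open>value_eq\<close> equal values already make them congruent.\<close>
      obtain u0 v0 where 0: "u0 \<in> lists A" "u = map k u0" "v0 \<in> lists A" "v = map k v0"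
        using uv(1,2) by (auto simp: lists_image)
      then have "(u0, v0) \<in> presentation_cong A R"
        using uv(3) value_eq by simp
      then show ?thesis
        unfolding 0
      proof (rule presentation_cong_map)
        fix u v
        assume uv: "(u, v) \<in> R"
        then have l: "u \<in> lists A" "v \<in> lists A" using R by auto
        moreover have "word_value M (map k u) = word_value M (map k v)"
          using value_eq[OF l] uv by (blast intro: presentation_cong.rel)
        ultimately show
          "(map k u, map k v) \<in> presentation_cong ?S (bounded_relations M ?S n)"
          using n[OF uv] by (intro bounded_relation_cong) auto
      qed simp
    qed
    then show ?thesis unfolding boundedly_presented_def by blast
  qed
  ultimately show ?thesis using A by blast
qed

text \<open>The bounded relations, recoded over natural numbers, form a finite presentation. Its
  congruence is equality of values: soundness gives one inclusion, the bound \<open>n\<close> the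
  other.\<close>

lemma boundedly_presented_imp_finitely_presentable:
  assumes "monoid M" "finite S" "generates M S" "boundedly_presented M S"
  shows "finitely_presentable M"
proof -
  interpret M: monoid M by fact
  have S: "S \<subseteq> carrier M" using assms(3) by (simp add: generates_def)
  obtain n where n: "\<And>u v. \<lbrakk>u \<in> lists S; v \<in> lists S; word_value M u = word_value M v\<rbrakk> \<Longrightarrow>
      (u, v) \<in> presentation_cong S (bounded_relations M S n)"
    using assms(4) unfolding boundedly_presented_def by blast
  obtain e :: "'a \<Rightarrow> nat" where e: "inj_on e S"
    using finite_imp_inj_to_nat_seg[OF assms(2)] by blast
  let ?A = "e ` S" and ?k = "the_inv_into S e"
  define R where "R = map_prod (map e) (map e) ` bounded_relations M S n"
  let ?P = "presented_monoid ?A R" and ?C = "\<lambda>u. presentation_cong ?A R `` {u}"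
  have R: "R \<subseteq> lists ?A \<times> lists ?A"
    by (auto simp: R_def bounded_relations_def)
  have ke: "map ?k (map e u) = u" if "u \<in> lists S" for u
    using that by (induction u) (auto simp: the_inv_into_f_f[OF e])
  have cong_iff: "(map e u, map e v) \<in> presentation_cong ?A R \<longleftrightarrow>
      word_value M u = word_value M v" if uv: "u \<in> lists S" "v \<in> lists S" for u v
  proof
    assume "(map e u, map e v) \<in> presentation_cong ?A R"
    then have "word_value M (map ?k (map e u)) = word_value M (map ?k (map e v))"
    proof (rule M.presentation_cong_word_value[OF _ R])
      show "?k ` ?A \<subseteq> carrier M" using S by (auto simp: the_inv_into_f_f[OF e])
    next
      fix u' v'
      assume "(u', v') \<in> R"
      then obtain x y where xy: "(x, y) \<in> bounded_relations M S n" "u' = map e x" "v' = map e y"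
        by (auto simp: R_def)
      then have "x \<in> lists S" "y \<in> lists S" "word_value M x = word_value M y"
        by (simp_all add: bounded_relations_def)
      then show "word_value M (map ?k u') = word_value M (map ?k v')"
        unfolding xy by (simp only: ke)
    qed
    then show "word_value M u = word_value M v"
      by (simp only: ke uv)
  next
    assume "word_value M u = word_value M v"
    from n[OF uv this] show "(map e u, map e v) \<in> presentation_cong ?A R"
      by (rule presentation_cong_map) (force simp: R_def intro!: presentation_cong.rel)+
  qed
  have mem: "map e u \<in> lists ?A" if "u \<in> lists S" for u using that by auto
  have cls: "?C (map e u) = ?C (map e v) \<longleftrightarrow> word_value M u = word_value M v"
    if "u \<in> lists S" "v \<in> lists S" for u v
    using presentation_cong_class_eq_iff[OF R mem[OF that(1)] mem[OF that(2)]] cong_iff[OF that]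
    by simp
  \<comment> \<open>A word is chosen for each element. By \<open>cls\<close> its class does not
    depend on the choice, which makes the map below multiplicative.\<close>
  obtain W where W: "\<And>x. x \<in> carrier M \<Longrightarrow> W x \<in> lists S \<and> word_value M (W x) = x"
    using assms(3) unfolding generates_def by metis
  have W_app: "W x @ W y \<in> lists S \<and> word_value M (W x @ W y) = x \<otimes>\<^bsub>M\<^esub> y"
    if "x \<in> carrier M" "y \<in> carrier M" for x y
    using W[OF that(1)] W[OF that(2)] S by (subst M.word_value_append) auto
  have "(\<lambda>x. ?C (map e (W x))) \<in> iso M ?P"
  proof (rule isoI)
    show "(\<lambda>x. ?C (map e (W x))) \<in> hom M ?P"
    proof (rule homI)
      fix x
      assume "x \<in> carrier M"
      then show "?C (map e (W x)) \<in> carrier ?P"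
        using W mem by (simp add: presented_monoid_def quotientI)
    next
      fix x y
      assume xy: "x \<in> carrier M" "y \<in> carrier M"
      have "?C (map e (W (x \<otimes>\<^bsub>M\<^esub> y))) = ?C (map e (W x @ W y))"
        using W[of "x \<otimes>\<^bsub>M\<^esub> y"] W_app[OF xy] xy by (subst cls) auto
      also have "\<dots> = ?C (map e (W x)) \<otimes>\<^bsub>?P\<^esub> ?C (map e (W y))"
        using W xy mem by (subst presented_monoid_mult_class[OF R]) auto
      finally show "?C (map e (W (x \<otimes>\<^bsub>M\<^esub> y))) = ?C (map e (W x)) \<otimes>\<^bsub>?P\<^esub> ?C (map e (W y))" .
    qed
    show "bij_betw (\<lambda>x. ?C (map e (W x))) (carrier M) (carrier ?P)"
      unfolding bij_betw_def
    proof (intro conjI inj_onI equalityI subsetI)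
      fix x y
      assume "x \<in> carrier M" "y \<in> carrier M" "?C (map e (W x)) = ?C (map e (W y))"
      then show "x = y" using W cls by metis
    next
      fix X
      assume "X \<in> (\<lambda>x. ?C (map e (W x))) ` carrier M"
      then show "X \<in> carrier ?P"
        using W mem by (auto simp: presented_monoid_def quotientI)
    next
      fix X
      assume "X \<in> carrier ?P"
      then obtain u where u: "u \<in> lists S" "X = ?C (map e u)"
        by (auto simp: presented_monoid_def lists_image elim!: quotientE)
      have x: "word_value M u \<in> carrier M" using u S by (intro M.word_value_closed) auto
      then have "X = ?C (map e (W (word_value M u)))"
        unfolding u(2) using W[OF x] u(1) by (subst cls) auto
      with x show "X \<in> (\<lambda>x. ?C (map e (W x))) ` carrier M" by blast
    qed
  qed
  moreover have "finite R" unfolding R_def using finite_bounded_relations[OF assms(2)] by blast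
  ultimately show ?thesis
    unfolding finitely_presentable_def is_iso_def using R assms(2) by blast
qed


section \<open>Transfer along coarse maps\<close>

text \<open>The word \<open>p x s\<close> labels the chosen path replacing the edge from \<open>x\<close> with label \<open>s\<close>.\<close>

primrec path_image ::
  "('a, 'm) monoid_scheme \<Rightarrow> ('a \<Rightarrow> 'a \<Rightarrow> 'b list) \<Rightarrow> 'a \<Rightarrow> 'a list \<Rightarrow> 'b list" where
  "path_image M p x [] = []"
| "path_image M p x (s # u) = p x s @ path_image M p (x \<otimes>\<^bsub>M\<^esub> s) u"

text \<open>A coarsely Lipschitz map between Cayley graphs: \<open>f\<close> need not be a
  homomorphism, but it sends each edge to a pair of points joined by a path of length at most
  \<open>K\<close>. Primed facts concern \<open>N\<close>.\<close>

locale path_map = M: left_cancellative_monoid M + N: left_cancellative_monoid N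
  for M :: "('a, 'm) monoid_scheme" and N :: "('b, 'n) monoid_scheme" +
  fixes S T and f :: "'a \<Rightarrow> 'b" and p and K :: nat
  assumes S: "S \<subseteq> carrier M" and T: "T \<subseteq> carrier N" and f: "f \<in> carrier M \<rightarrow> carrier N"
    and p: "\<And>x s. \<lbrakk>x \<in> carrier M; s \<in> S\<rbrakk> \<Longrightarrow>
      p x s \<in> lists T \<and> length (p x s) \<le> K \<and> f x \<otimes>\<^bsub>N\<^esub> word_value N (p x s) = f (x \<otimes>\<^bsub>M\<^esub> s)"
begin

lemma value_closed: "u \<in> lists S \<Longrightarrow> word_value M u \<in> carrier M"
  using S by (intro M.word_value_closed) auto

lemma value_closed': "u \<in> lists T \<Longrightarrow> word_value N u \<in> carrier N"
  using T by (intro N.word_value_closed) auto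

lemma value_append':
  "\<lbrakk>u \<in> lists T; v \<in> lists T\<rbrakk> \<Longrightarrow> word_value N (u @ v) = word_value N u \<otimes>\<^bsub>N\<^esub> word_value N v"
  using T by (intro N.word_value_append) auto

text \<open>The pieces fit together because each one ends at the \<open>f\<close>-image of the
  vertex where the next one starts; hence the induction with a moving base point.\<close>

lemma path_image:
  assumes "x \<in> carrier M" "u \<in> lists S"
  shows "path_image M p x u \<in> lists T \<and> length (path_image M p x u) \<le> K * length u \<and>
    f x \<otimes>\<^bsub>N\<^esub> word_value N (path_image M p x u) = f (x \<otimes>\<^bsub>M\<^esub> word_value M u)"
  using assms(2,1)
proof (induction u arbitrary: x)
  case Nil
  then show ?case using funcset_mem[OF f Nil] by (simp add: word_value_def)
next
  case (Cons s u)
  then have s: "s \<in> carrier M" using S by auto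
  note ps = p[OF \<open>x \<in> carrier M\<close> \<open>s \<in> S\<close>]
  note IH = Cons.IH[OF M.m_closed[OF \<open>x \<in> carrier M\<close> s]]
  have l: "p x s \<in> lists T" "path_image M p (x \<otimes>\<^bsub>M\<^esub> s) u \<in> lists T" using ps IH by auto
  have "f x \<otimes>\<^bsub>N\<^esub> word_value N (path_image M p x (s # u))
      = f x \<otimes>\<^bsub>N\<^esub> word_value N (p x s) \<otimes>\<^bsub>N\<^esub> word_value N (path_image M p (x \<otimes>\<^bsub>M\<^esub> s) u)"
    by (simp only: path_image.simps value_append'[OF l] N.m_assoc funcset_mem[OF f Cons.prems]
        value_closed'[OF l(1)] value_closed'[OF l(2)])
  also have "\<dots> = f (x \<otimes>\<^bsub>M\<^esub> (s \<otimes>\<^bsub>M\<^esub> word_value M u))"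
    using ps IH Cons s by (simp add: M.m_assoc value_closed)
  finally show ?case using ps IH by (auto simp: word_value_def)
qed

lemma path_image_append:
  assumes "x \<in> carrier M" "u \<in> lists S" "v \<in> lists S"
  shows "path_image M p x (u @ v) =
    path_image M p x u @ path_image M p (x \<otimes>\<^bsub>M\<^esub> word_value M u) v"
  using assms(2,1)
proof (induction u arbitrary: x)
  case Nil
  then show ?case by (simp add: word_value_def)
next
  case (Cons s u)
  then have s: "s \<in> carrier M" using S by auto
  have "x \<otimes>\<^bsub>M\<^esub> s \<otimes>\<^bsub>M\<^esub> word_value M u = x \<otimes>\<^bsub>M\<^esub> word_value M (s # u)"
    using Cons s value_closed by (simp add: word_value_def M.m_assoc)
  then show ?case using Cons.IH[OF M.m_closed[OF Cons.prems s]] by simp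
qed

text \<open>Both image paths run from \<open>f x\<close> to the same vertex, and left cancellation
  in \<open>N\<close> removes \<open>f x\<close>.\<close>

lemma path_image_value_cong:
  assumes "x \<in> carrier M" "u \<in> lists S" "v \<in> lists S" "word_value M u = word_value M v"
  shows "word_value N (path_image M p x u) = word_value N (path_image M p x v)"
proof (rule N.left_cancel)
  show "f x \<in> carrier N" using f assms(1) by auto
  show "f x \<otimes>\<^bsub>N\<^esub> word_value N (path_image M p x u) =
      f x \<otimes>\<^bsub>N\<^esub> word_value N (path_image M p x v)"
    using path_image[OF assms(1,2)] path_image[OF assms(1,3)] assms(4) by simp
qed (use path_image assms value_closed' in blast)+

text \<open>A cell with sides of length at most \<open>n\<close> is mapped to one with sides of
  length at most \<open>K * n\<close>, from whatever vertex it is read.\<close>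

lemma path_image_cong:
  assumes "(u, v) \<in> presentation_cong S (bounded_relations M S n)" "K * n \<le> m" "x \<in> carrier M"
  shows "(path_image M p x u, path_image M p x v) \<in>
    presentation_cong T (bounded_relations N T m)"
  using assms(1,3)
proof (induction arbitrary: x)
  case (rel u v)
  then have uv: "u \<in> lists S" "v \<in> lists S" "length u \<le> n" "length v \<le> n"
      "word_value M u = word_value M v"
    by (auto simp: bounded_relations_def)
  have "K * length u \<le> m" "K * length v \<le> m"
    using uv(3,4) assms(2) by (meson mult_le_mono2 order_trans)+
  then show ?case
    using path_image[OF rel.prems uv(1)] path_image[OF rel.prems uv(2)]
      path_image_value_cong[OF rel.prems uv(1,2,5)]
    by (intro bounded_relation_cong) auto
next
  case (refl u)
  then show ?case using path_image by (intro presentation_cong.refl) blast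
next
  case (append u v u' v')
  note l = presentation_cong_lists[OF bounded_relations_subset append.hyps(1)]
    presentation_cong_lists[OF bounded_relations_subset append.hyps(2)]
  \<comment> \<open>The second factors are read from the endpoints of the first ones. These coincide
    by soundness, so the induction hypothesis applies at a common base point.\<close>
  have eq: "word_value M u = word_value M v"
    using M.presentation_cong_word_value[OF append.hyps(1) bounded_relations_subset, of id] S
    by (auto simp: bounded_relations_def)
  have "x \<otimes>\<^bsub>M\<^esub> word_value M u \<in> carrier M" using append.prems value_closed l by simp
  then show ?case
    using append.IH append.prems l eq
    by (auto simp: path_image_append intro!: presentation_cong.append)
qed (blast intro: presentation_cong.sym presentation_cong.trans)+

end

text \<open>The words \<open>a y\<close> and \<open>b y\<close> join \<open>y\<close> to
  \<open>f (g y)\<close> and back; both are given because paths in a Cayley graph of a monoid cannot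
  be reversed.\<close>

lemma boundedly_presented_transfer:
  fixes M :: "('a, 'm) monoid_scheme" and N :: "('b, 'n) monoid_scheme"
  assumes F: "path_map M N S T f p K" and G: "path_map N M T S g q K"
    and a: "\<And>y. y \<in> carrier N \<Longrightarrow>
      a y \<in> lists T \<and> length (a y) \<le> K \<and> y \<otimes>\<^bsub>N\<^esub> word_value N (a y) = f (g y)"
    and b: "\<And>y. y \<in> carrier N \<Longrightarrow>
      b y \<in> lists T \<and> length (b y) \<le> K \<and> f (g y) \<otimes>\<^bsub>N\<^esub> word_value N (b y) = y"
    and "boundedly_presented M S"
  shows "boundedly_presented N T"
proof -
  interpret F: path_map M N S T f p K by fact
  interpret G: path_map N M T S g q K by fact
  obtain n where n: "\<And>u v. \<lbrakk>u \<in> lists S; v \<in> lists S; word_value M u = word_value M v\<rbrakk> \<Longrightarrow>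
      (u, v) \<in> presentation_cong S (bounded_relations M S n)"
    using assms(5) unfolding boundedly_presented_def by blast
  \<comment> \<open>\<open>K * n\<close> bounds the cells transported from \<open>M\<close>;
    \<open>K * K + 2 * K\<close> bounds the detour replacing one edge, with its connecting paths.
    The 1 leaves room for the edge itself when \<open>K\<close> is 0.\<close>
  define m where "m = K * n + K * K + 2 * K + 1"
  let ?c = "presentation_cong T (bounded_relations N T m)"
  let ?G = "\<lambda>y w. path_image N q y w"
  let ?FG = "\<lambda>y w. path_image M p (g y) (?G y w)"
  have gy: "g y \<in> carrier M" if "y \<in> carrier N" for y using that G.f by auto
  have FG: "?FG y w \<in> lists T \<and> length (?FG y w) \<le> K * (K * length w) \<and>
      f (g y) \<otimes>\<^bsub>N\<^esub> word_value N (?FG y w) = f (g (y \<otimes>\<^bsub>N\<^esub> word_value N w))"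
    if "y \<in> carrier N" "w \<in> lists T" for y w
  proof -
    note G = G.path_image[OF that]
    then have "K * length (?G y w) \<le> K * (K * length w)" by simp
    with G F.path_image[OF gy[OF that(1)], of "?G y w"] show ?thesis by (auto intro: order_trans)
  qed
  have value_app: "x \<otimes>\<^bsub>N\<^esub> word_value N (u @ v) = x \<otimes>\<^bsub>N\<^esub> word_value N u \<otimes>\<^bsub>N\<^esub> word_value N v"
    if "x \<in> carrier N" "u \<in> lists T" "v \<in> lists T" for x u v
    using that(1) F.value_closed'[OF that(2)] F.value_closed'[OF that(3)]
    by (simp only: F.value_append'[OF that(2,3)] F.N.m_assoc)
  have ends: "a y \<in> lists T" "b y \<in> lists T" "length (a y) \<le> K" "length (b y) \<le> K"
      "y \<otimes>\<^bsub>N\<^esub> word_value N (a y) = f (g y)" "f (g y) \<otimes>\<^bsub>N\<^esub> word_value N (b y) = y"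
    if "y \<in> carrier N" for y
    using a[OF that] b[OF that] by blast+
  \<comment> \<open>By left cancellation, short parallel paths from any vertex \<open>x\<close> form
    a single defining relation.\<close>
  have cancel: "(u, v) \<in> ?c"
    if "x \<in> carrier N" "x \<otimes>\<^bsub>N\<^esub> word_value N u = x \<otimes>\<^bsub>N\<^esub> word_value N v"
      "u \<in> lists T" "v \<in> lists T" "length u \<le> m" "length v \<le> m" for x u v
    using that F.N.left_cancel[OF that(1) F.value_closed'[OF that(3)] F.value_closed'[OF that(4)]]
    by (intro bounded_relation_cong) blast+
  \<comment> \<open>This fills the strip between \<open>w\<close> and its double image, one edge at
    a time. For the empty word the strip is the closed path \<open>a y @ b y\<close>.\<close>
  have return: "(w, a y @ ?FG y w @ b (y \<otimes>\<^bsub>N\<^esub> word_value N w)) \<in> ?c"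
    if "w \<in> lists T" "y \<in> carrier N" for y w
    using that
  proof (induction w arbitrary: y)
    case Nil
    have "y \<otimes>\<^bsub>N\<^esub> word_value N (a y @ b y) = y"
      by (simp only: value_app[OF Nil ends(1,2)[OF Nil]] ends(5,6)[OF Nil])
    moreover have "length (a y @ b y) \<le> m"
      using ends(3,4)[OF Nil] by (simp add: m_def)
    ultimately have "([], a y @ b y) \<in> ?c"
      using Nil ends(1,2)[OF Nil] by (intro cancel[OF Nil]) (simp_all add: word_value_def)
    then show ?case using Nil by (simp add: word_value_def)
  next
    case (Cons t w)
    have t: "t \<in> carrier N" "[t] \<in> lists T" using Cons.hyps F.T by auto
    define z where "z = y \<otimes>\<^bsub>N\<^esub> t"
    have z: "z \<in> carrier N" using Cons.prems t by (simp add: z_def)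
    note ay = ends[OF Cons.prems] and ez = ends[OF z]
    have vt: "y \<otimes>\<^bsub>N\<^esub> word_value N [t] = z"
      using t by (simp add: z_def word_value_def)
    note FGt = FG[OF Cons.prems t(2), unfolded vt] and FGw = FG[OF z Cons.hyps(2)]
    have end_eq: "y \<otimes>\<^bsub>N\<^esub> word_value N (t # w) = z \<otimes>\<^bsub>N\<^esub> word_value N w"
      using Cons t by (simp add: z_def word_value_def F.N.m_assoc
          F.value_closed'[unfolded word_value_def])
    have fgz: "f (g z) \<in> carrier N" using gy[OF z] F.f by auto
    let ?r = "b (z \<otimes>\<^bsub>N\<^esub> word_value N w)"
    have r: "?r \<in> lists T" using z Cons.hyps F.value_closed' by (intro ends(2)) blast
    have FGsplit: "?FG y (t # w) = ?FG y [t] @ ?FG z w"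
    proof -
      have q: "?G y [t] \<in> lists S" "g y \<otimes>\<^bsub>M\<^esub> word_value M (?G y [t]) = g z"
        using G.path_image[OF Cons.prems t(2)] vt by auto
      have "?G y (t # w) = ?G y [t] @ ?G z w" by (simp add: z_def)
      then show ?thesis
        using F.path_image_append[OF gy[OF Cons.prems] q(1), of "?G z w"] q(2)
          G.path_image[OF z Cons.hyps(2)] by simp
    qed
    \<comment> \<open>The cell over one edge: \<open>t\<close> and the detour through
      \<open>f (g y)\<close> and \<open>f (g z)\<close> both lead from \<open>y\<close> to
      \<open>z\<close>.\<close>
    have edge: "([t], a y @ ?FG y [t] @ b z) \<in> ?c"
    proof (rule cancel[OF Cons.prems])
      have l: "?FG y [t] \<in> lists T" using FGt by blast
      have "y \<otimes>\<^bsub>N\<^esub> word_value N ((a y @ ?FG y [t]) @ b z)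
          = y \<otimes>\<^bsub>N\<^esub> word_value N (a y) \<otimes>\<^bsub>N\<^esub> word_value N (?FG y [t]) \<otimes>\<^bsub>N\<^esub> word_value N (b z)"
        using l Cons.prems ay(1) ez(2) by (simp only: value_app append_in_lists_conv simp_thms)
      also have "\<dots> = z" using ay(5) ez(6) FGt by (simp only:)
      finally show "y \<otimes>\<^bsub>N\<^esub> word_value N [t] = y \<otimes>\<^bsub>N\<^esub> word_value N (a y @ ?FG y [t] @ b z)"
        by (simp only: append_assoc vt)
      show "a y @ ?FG y [t] @ b z \<in> lists T"
        using l ay(1) ez(2) by (simp only: append_in_lists_conv simp_thms)
      show "length (a y @ ?FG y [t] @ b z) \<le> m"
        using FGt ay(3) ez(4) by (simp add: m_def del: path_image.simps)
    qed (use t(2) in \<open>simp_all add: m_def\<close>)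
    \<comment> \<open>Consecutive detours meet in \<open>b z @ a z\<close>, a closed path at
      \<open>f (g z)\<close>, which can be erased.\<close>
    have loop: "(b z @ a z, []) \<in> ?c"
    proof (rule cancel[OF fgz])
      show "f (g z) \<otimes>\<^bsub>N\<^esub> word_value N (b z @ a z) = f (g z) \<otimes>\<^bsub>N\<^esub> word_value N []"
        using fgz by (simp only: value_app[OF fgz ez(2,1)] ez(5,6)) (simp add: word_value_def)
    qed (use ez(1-4) in \<open>simp_all add: m_def\<close>)
    have "([t] @ w, (a y @ ?FG y [t] @ b z) @ (a z @ ?FG z w @ ?r)) \<in> ?c"
      using edge Cons.IH[OF z] by (rule presentation_cong.append)
    moreover have "((a y @ ?FG y [t]) @ (b z @ a z) @ (?FG z w @ ?r),
        (a y @ ?FG y [t]) @ [] @ (?FG z w @ ?r)) \<in> ?c"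
      using ay(1) FGt FGw r unfolding append_in_lists_conv
      by (intro presentation_cong.append loop presentation_cong.refl) blast+
    ultimately have "(t # w, a y @ (?FG y [t] @ ?FG z w) @ ?r) \<in> ?c"
      unfolding append_assoc append_Cons append_Nil by (rule presentation_cong.trans)
    then show ?case unfolding end_eq FGsplit .
  qed
  have "(u, v) \<in> ?c" if uv: "u \<in> lists T" "v \<in> lists T" "word_value N u = word_value N v" for u v
  proof -
    let ?e = "\<one>\<^bsub>N\<^esub>"
    have e: "?e \<in> carrier N" by simp
    have Kn: "K * n \<le> m" by (simp add: m_def)
    \<comment> \<open>The words are carried to \<open>M\<close>, filled there, and the filling is
      carried back by \<open>f\<close>. Equal values give equal endpoints, so the same connecting
      words close both strips.\<close>
    have "(?G ?e u, ?G ?e v) \<in> presentation_cong S (bounded_relations M S n)"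
      using G.path_image[OF e uv(1)] G.path_image[OF e uv(2)]
        G.path_image_value_cong[OF e uv] by (intro n) auto
    then have "(?FG ?e u, ?FG ?e v) \<in> ?c"
      by (rule F.path_image_cong[OF _ Kn gy[OF e]])
    then have "(a ?e @ ?FG ?e u @ b (?e \<otimes>\<^bsub>N\<^esub> word_value N u),
        a ?e @ ?FG ?e v @ b (?e \<otimes>\<^bsub>N\<^esub> word_value N v)) \<in> ?c"
      unfolding uv(3) using ends(1)[OF e] ends(2) F.value_closed'[OF uv(2)]
      by (intro presentation_cong.append presentation_cong.refl) simp_all
    with return[OF uv(1) e] return[OF uv(2) e] show ?thesis
      by (meson presentation_cong.sym presentation_cong.trans)
  qed
  then show ?thesis unfolding boundedly_presented_def by blast
qed


section \<open>Coarse equivalence\<close>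

text \<open>\<open>N\<close> is a coarse retract of \<open>M\<close>: both maps are Lipschitz on
  edges, and \<open>f\<close> after \<open>g\<close> is close to the identity of \<open>N\<close>.
  Being one-sided, this is exactly the input of the transfer, and it also covers a change of
  generators.\<close>

definition coarsely_dominates ::
  "('a, 'm) monoid_scheme \<Rightarrow> 'a set \<Rightarrow> ('b, 'n) monoid_scheme \<Rightarrow> 'b set \<Rightarrow> bool" where
  "coarsely_dominates M S N T \<longleftrightarrow> (\<exists>f g. \<exists>K :: nat.
     f \<in> carrier M \<rightarrow> carrier N \<and> g \<in> carrier N \<rightarrow> carrier M \<and>
     (\<forall>x\<in>carrier M. \<forall>s\<in>S. word_dist N T (f x) (f (x \<otimes>\<^bsub>M\<^esub> s)) \<le> of_nat K) \<and>
     (\<forall>y\<in>carrier N. \<forall>t\<in>T. word_dist M S (g y) (g (y \<otimes>\<^bsub>N\<^esub> t)) \<le> of_nat K) \<and>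
     (\<forall>y\<in>carrier N. word_dist N T y (f (g y)) \<le> of_nat K \<and> word_dist N T (f (g y)) y \<le> of_nat K))"

lemma (in monoid) word_dist_le_of_natD:
  assumes "word_dist G S x y \<le> of_nat k"
  shows "\<exists>w. w \<in> lists S \<and> length w \<le> k \<and> x \<otimes> word_value G w = y"
proof -
  have "word_dist G S x y \<noteq> \<infinity>"
    using assms by (auto simp: top_unique)
  then obtain w where "w \<in> lists S" "x \<otimes> word_value G w = y"
      "word_dist G S x y = of_nat (length w)"
    by (rule word_dist_attained)
  then show ?thesis using assms by auto
qed

text \<open>Finite distances are attained by words, so bounds on distances become the chosen paths
  \<open>c\<close> and \<open>d\<close> that the transfer works with.\<close>

lemma boundedly_presented_coarsely_dominates:
  assumes M: "left_cancellative_monoid M" and N: "left_cancellative_monoid N"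
    and S: "S \<subseteq> carrier M" and T: "T \<subseteq> carrier N"
    and dom: "coarsely_dominates M S N T" and bp: "boundedly_presented M S"
  shows "boundedly_presented N T"
proof -
  interpret M: left_cancellative_monoid M by fact
  interpret N: left_cancellative_monoid N by fact
  obtain f g and K :: nat where
    fg: "f \<in> carrier M \<rightarrow> carrier N" "g \<in> carrier N \<rightarrow> carrier M" and
    1: "\<forall>x\<in>carrier M. \<forall>s\<in>S. word_dist N T (f x) (f (x \<otimes>\<^bsub>M\<^esub> s)) \<le> of_nat K" and
    2: "\<forall>y\<in>carrier N. \<forall>t\<in>T. word_dist M S (g y) (g (y \<otimes>\<^bsub>N\<^esub> t)) \<le> of_nat K" and
    3: "\<forall>y\<in>carrier N. word_dist N T y (f (g y)) \<le> of_nat K" and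
    4: "\<forall>y\<in>carrier N. word_dist N T (f (g y)) y \<le> of_nat K"
    using dom unfolding coarsely_dominates_def by blast
  obtain c where c: "\<And>x y. word_dist N T x y \<le> of_nat K \<Longrightarrow>
      c x y \<in> lists T \<and> length (c x y) \<le> K \<and> x \<otimes>\<^bsub>N\<^esub> word_value N (c x y) = y"
    using N.word_dist_le_of_natD[of T _ _ K] by metis
  obtain d where d: "\<And>x y. word_dist M S x y \<le> of_nat K \<Longrightarrow>
      d x y \<in> lists S \<and> length (d x y) \<le> K \<and> x \<otimes>\<^bsub>M\<^esub> word_value M (d x y) = y"
    using M.word_dist_le_of_natD[of S _ _ K] by metis
  have "path_map M N S T f (\<lambda>x s. c (f x) (f (x \<otimes>\<^bsub>M\<^esub> s))) K"
    by unfold_locales (use S T fg 1 c in blast)+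
  moreover have "path_map N M T S g (\<lambda>y t. d (g y) (g (y \<otimes>\<^bsub>N\<^esub> t))) K"
    by unfold_locales (use S T fg 2 d in blast)+
  ultimately show ?thesis
    by (rule boundedly_presented_transfer[where a = "\<lambda>y. c y (f (g y))" and b = "\<lambda>y. c (f (g y)) y"])
      (use 3 4 c bp in blast)+
qed

section \<open>Change of finite generating set\<close>

text \<open>A word over \<open>T\<close> spelling \<open>s\<close> leads from \<open>x\<close> to
  the product of \<open>x\<close> and \<open>s\<close> for every \<open>x\<close>, so finitely many
  words give a uniform bound.\<close>

lemma (in monoid) word_dist_generator_bounded:
  assumes "finite S" "S \<subseteq> carrier G" "generates G T"
  shows "\<exists>k :: nat. \<forall>x\<in>carrier G. \<forall>s\<in>S. word_dist G T x (x \<otimes> s) \<le> of_nat k"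
proof -
  obtain W where W: "\<And>s. s \<in> S \<Longrightarrow> W s \<in> lists T \<and> word_value G (W s) = s"
    using assms(2,3) unfolding generates_def by (metis subsetD)
  have "word_dist G T x (x \<otimes> s) \<le> of_nat (Max (length ` W ` S))"
    if "x \<in> carrier G" "s \<in> S" for x s
  proof -
    have "word_dist G T x (x \<otimes> s) \<le> of_nat (length (W s))"
      using W[OF that(2)] by (intro word_dist_le) auto
    also have "\<dots> \<le> of_nat (Max (length ` W ` S))"
      using assms(1) that(2) by simp
    finally show ?thesis .
  qed
  then show ?thesis by blast
qed

text \<open>Identity maps serve as \<open>f\<close> and \<open>g\<close>. This links the generators
  that come from a presentation with those of the given quasi-isometry.\<close>

lemma coarsely_dominates_same_monoid:
  assumes "monoid M" "finite S" "generates M S" "finite T" "generates M T"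
  shows "coarsely_dominates M S M T"
proof -
  interpret M: monoid M by fact
  have sub: "S \<subseteq> carrier M" "T \<subseteq> carrier M" using assms by (auto simp: generates_def)
  obtain k :: nat where k: "\<forall>x\<in>carrier M. \<forall>s\<in>S. word_dist M T x (x \<otimes>\<^bsub>M\<^esub> s) \<le> of_nat k"
    using M.word_dist_generator_bounded[OF assms(2) sub(1) assms(5)] by blast
  obtain l :: nat where l: "\<forall>x\<in>carrier M. \<forall>s\<in>T. word_dist M S x (x \<otimes>\<^bsub>M\<^esub> s) \<le> of_nat l"
    using M.word_dist_generator_bounded[OF assms(4) sub(2) assms(3)] by blast
  have 0: "word_dist M T x x = 0" if "x \<in> carrier M" for x
    using semimetric_space.dist_eq_0_iff[OF M.word_dist_semimetric[OF sub(2)]] that by blast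
  have "d \<le> (of_nat k :: ennreal) \<Longrightarrow> d \<le> of_nat (max k l)"
    "d \<le> (of_nat l :: ennreal) \<Longrightarrow> d \<le> of_nat (max k l)" for d
    by (erule order_trans, simp only: of_nat_le_iff max.cobounded1 max.cobounded2)+
  then show ?thesis
    unfolding coarsely_dominates_def using k l 0
    by (intro exI[of _ "\<lambda>x. x"] exI[of _ "max k l"]) simp
qed

section \<open>From quasi-isometries to coarse domination\<close>

text \<open>Quasi-density supplies a quasi-inverse \<open>g\<close>; the lower bound for
  \<open>f\<close> makes \<open>g\<close> Lipschitz on edges and puts \<open>g\<close> after
  \<open>f\<close> close to the identity. The same pair then serves both directions.\<close>

lemma quasi_isometric_coarsely_dominates:
  assumes M: "monoid M" and N: "monoid N" and S: "S \<subseteq> carrier M" and T: "T \<subseteq> carrier N"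
    and "quasi_isometric (carrier M) (word_dist M S) (carrier N) (word_dist N T)"
  shows "coarsely_dominates M S N T" "coarsely_dominates N T M S"
proof -
  interpret M: monoid M by fact
  interpret N: monoid N by fact
  interpret dM: semimetric_space "carrier M" "word_dist M S" by (rule M.word_dist_semimetric[OF S])
  interpret dN: semimetric_space "carrier N" "word_dist N T" by (rule N.word_dist_semimetric[OF T])
  let ?dM = "word_dist M S" and ?dN = "word_dist N T"
  obtain l \<epsilon> \<mu> f where c: "1 \<le> l" "0 < \<epsilon>" "0 \<le> \<mu>" and f: "f \<in> carrier M \<rightarrow> carrier N"
    and lower: "\<And>x y. \<lbrakk>x \<in> carrier M; y \<in> carrier M\<rbrakk> \<Longrightarrow>
      ?dM x y / ennreal l - ennreal \<epsilon> \<le> ?dN (f x) (f y)"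
    and upper: "\<And>x y. \<lbrakk>x \<in> carrier M; y \<in> carrier M\<rbrakk> \<Longrightarrow>
      ?dN (f x) (f y) \<le> ennreal l * ?dM x y + ennreal \<epsilon>"
    and dense: "\<And>y. y \<in> carrier N \<Longrightarrow>
      \<exists>x\<in>carrier M. ?dN y (f x) \<le> ennreal \<mu> \<and> ?dN (f x) y \<le> ennreal \<mu>"
    using assms(5)
    unfolding quasi_isometric_def quasi_isometry_def quasi_isometric_embedding_def quasi_dense_def
    by auto
  obtain g where g: "\<And>y. y \<in> carrier N \<Longrightarrow>
      g y \<in> carrier M \<and> ?dN y (f (g y)) \<le> ennreal \<mu> \<and> ?dN (f (g y)) y \<le> ennreal \<mu>"
    using dense by metis
  have fc: "f x \<in> carrier N" if "x \<in> carrier M" for x using f that by auto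
  have lower': "?dM x y \<le> ennreal (l * (r + \<epsilon>))"
    if "x \<in> carrier M" "y \<in> carrier M" "?dN (f x) (f y) \<le> ennreal r" "0 \<le> r" for x y r
  proof -
    have "?dM x y / ennreal l - ennreal \<epsilon> \<le> ennreal r"
      using lower[OF that(1,2)] that(3) by (rule order_trans)
    then have "?dM x y / ennreal l \<le> ennreal r + ennreal \<epsilon>"
      by (simp add: ennreal_minus_le_iff add.commute)
    then have "ennreal l * (?dM x y / ennreal l) \<le> ennreal l * (ennreal r + ennreal \<epsilon>)"
      by (rule mult_left_mono) simp
    \<comment> \<open>This holds for infinite distances too, as \<open>l\<close> is finite and
      nonzero.\<close>
    moreover have "ennreal l * (?dM x y / ennreal l) = ?dM x y"
      using c mult_divide_eq_ennreal[of "ennreal l" "?dM x y"]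
      by (simp add: ennreal_times_divide mult.commute)
    ultimately show ?thesis
      using c that(4) by (simp add: ennreal_mult ennreal_plus)
  qed
  have stepM: "?dM x (x \<otimes>\<^bsub>M\<^esub> s) \<le> 1" if "x \<in> carrier M" "s \<in> S" for x s
    using M.word_dist_le[of "[s]" S x] that S by (auto simp: word_value_def)
  have stepN: "?dN y (y \<otimes>\<^bsub>N\<^esub> t) \<le> 1" if "y \<in> carrier N" "t \<in> T" for y t
    using N.word_dist_le[of "[t]" T y] that T by (auto simp: word_value_def)
  have 1: "?dN (f x) (f (x \<otimes>\<^bsub>M\<^esub> s)) \<le> ennreal (l + \<epsilon>)" if "x \<in> carrier M" "s \<in> S" for x s
  proof -
    have "?dN (f x) (f (x \<otimes>\<^bsub>M\<^esub> s)) \<le> ennreal l * ?dM x (x \<otimes>\<^bsub>M\<^esub> s) + ennreal \<epsilon>"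
      using that S by (intro upper) auto
    also have "\<dots> \<le> ennreal l * 1 + ennreal \<epsilon>"
      using stepM[OF that] by (intro add_right_mono mult_left_mono) auto
    finally show ?thesis using c by (simp add: ennreal_plus)
  qed
  \<comment> \<open>\<open>\<mu> + 1 + \<mu>\<close> is the route from \<open>f (g y)\<close> to
    \<open>y\<close>, along the edge \<open>t\<close>, and on to the image of its endpoint.\<close>
  have 2: "?dM (g y) (g (y \<otimes>\<^bsub>N\<^esub> t)) \<le> ennreal (l * ((\<mu> + 1 + \<mu>) + \<epsilon>))"
    if "y \<in> carrier N" "t \<in> T" for y t
  proof (rule lower')
    let ?z = "y \<otimes>\<^bsub>N\<^esub> t"
    have z: "?z \<in> carrier N" using that T by auto
    then show "g y \<in> carrier M" "g ?z \<in> carrier M" using g that by auto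
    have "?dN (f (g y)) (f (g ?z)) \<le> ?dN (f (g y)) y + ?dN y (f (g ?z))"
      using fc g z that by (intro dN.dist_triangle) auto
    also have "\<dots> \<le> ?dN (f (g y)) y + (?dN y ?z + ?dN ?z (f (g ?z)))"
      using fc g z that by (intro add_left_mono dN.dist_triangle) auto
    also have "\<dots> \<le> ennreal \<mu> + (1 + ennreal \<mu>)"
      using g z that stepN by (intro add_mono) auto
    also have "\<dots> = ennreal (\<mu> + 1 + \<mu>)"
      using c by (simp add: add.assoc flip: ennreal_1 ennreal_plus)
    finally show "?dN (f (g y)) (f (g ?z)) \<le> ennreal (\<mu> + 1 + \<mu>)" .
  qed (use c in auto)
  have 3: "?dM x (g (f x)) \<le> ennreal (l * (\<mu> + \<epsilon>))" "?dM (g (f x)) x \<le> ennreal (l * (\<mu> + \<epsilon>))"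
    if "x \<in> carrier M" for x
    using that g[OF fc[OF that]] c by (auto intro!: lower')
  \<comment> \<open>Domination asks for one natural number; this one lies above all four
    bounds.\<close>
  define K where "K = nat \<lceil>Max {l + \<epsilon>, l * ((\<mu> + 1 + \<mu>) + \<epsilon>), l * (\<mu> + \<epsilon>), \<mu>}\<rceil>"
  have K: "d \<le> of_nat K"
    if "d \<le> ennreal r" "r \<in> {l + \<epsilon>, l * ((\<mu> + 1 + \<mu>) + \<epsilon>), l * (\<mu> + \<epsilon>), \<mu>}" for d r
  proof -
    have "r \<le> Max {l + \<epsilon>, l * ((\<mu> + 1 + \<mu>) + \<epsilon>), l * (\<mu> + \<epsilon>), \<mu>}"
      using that(2) by (intro Max_ge) auto
    also have "\<dots> \<le> real K" unfolding K_def by (rule real_nat_ceiling_ge)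
    finally have "ennreal r \<le> of_nat K"
      by (simp add: ennreal_leI flip: ennreal_of_nat_eq_real_of_nat)
    with that(1) show ?thesis by (rule order_trans)
  qed
  have fg: "f \<in> carrier M \<rightarrow> carrier N" "g \<in> carrier N \<rightarrow> carrier M" using f g by auto
  note bounds = K[OF 1] K[OF 2] K[OF 3(1)] K[OF 3(2)]
  show "coarsely_dominates M S N T"
    unfolding coarsely_dominates_def
    by (intro exI[of _ f] exI[of _ g] exI[of _ K] conjI ballI fg bounds K[of _ \<mu>])
      (use g in auto)
  show "coarsely_dominates N T M S"
    unfolding coarsely_dominates_def
    by (intro exI[of _ g] exI[of _ f] exI[of _ K] conjI ballI fg bounds) auto
qed

section \<open>Invariance of finite presentability\<close>

text \<open>The bounded filling property passes from the generators \<open>A\<close> of a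
  presentation to \<open>S\<close> inside \<open>M\<close>, then to \<open>T\<close> in
  \<open>N\<close>, where it yields a finite presentation.\<close>

lemma finitely_presentable_coarsely_dominates:
  assumes M: "left_cancellative_monoid M" and N: "left_cancellative_monoid N"
    and S: "finite S" "generates M S" and T: "finite T" "generates N T"
    and dom: "coarsely_dominates M S N T" and fp: "finitely_presentable M"
  shows "finitely_presentable N"
proof -
  have mon: "monoid M" "monoid N"
    using M N by (simp_all add: left_cancellative_monoid_def)
  obtain A where A: "finite A" "generates M A" "boundedly_presented M A"
    using finitely_presentable_imp_boundedly_presented[OF mon(1) fp] by blast
  have sub: "A \<subseteq> carrier M" "S \<subseteq> carrier M" "T \<subseteq> carrier N"
    using A S T by (auto simp: generates_def)
  have "boundedly_presented M S"
    using coarsely_dominates_same_monoid[OF mon(1) A(1,2) S] A(3)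
    by (rule boundedly_presented_coarsely_dominates[OF M M sub(1,2)])
  with dom have "boundedly_presented N T"
    by (rule boundedly_presented_coarsely_dominates[OF M N sub(2,3)])
  with T show ?thesis
    by (rule boundedly_presented_imp_finitely_presentable[OF mon(2)])
qed

theorem theoremA:
  fixes M :: "('a, 'm) monoid_scheme" and N :: "('b, 'n) monoid_scheme"
  assumes "left_cancellative_monoid M" and "left_cancellative_monoid N"
    and "finitely_generated M" and "finitely_generated N"
    and "quasi_isometric_monoids M N"
  shows "finitely_presentable M \<longleftrightarrow> finitely_presentable N"
proof -
  obtain S T where S: "finite S" "generates M S" and T: "finite T" "generates N T"
    and qi: "quasi_isometric (carrier M) (word_dist M S) (carrier N) (word_dist N T)"
    using assms(5) unfolding quasi_isometric_monoids_def by blast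
  have mon: "monoid M" "monoid N"
    using assms(1,2) by (simp_all add: left_cancellative_monoid_def)
  have sub: "S \<subseteq> carrier M" "T \<subseteq> carrier N" using S T by (auto simp: generates_def)
  \<comment> \<open>A single quasi-isometry gives domination both ways, so each implication is an
    instance of the same lemma.\<close>
  note dom = quasi_isometric_coarsely_dominates[OF mon sub qi]
  show ?thesis
    using finitely_presentable_coarsely_dominates[OF assms(1,2) S T dom(1)]
      finitely_presentable_coarsely_dominates[OF assms(2,1) T S dom(2)] by blast
qed

end
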